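(* Let $\lambda>0$. Let $\bm{M}\succeq\bm{O}$ be a feasible solution of the primal problem, and let $\bm{\alpha}$ and $\bm{\Gamma}$ be feasible solutions of the dual problem, i.e. $\bm{0}\le\bm{\alpha}\le\bm{1}$ and $\bm{\Gamma}\succeq\bm{O}$. Then the optimal solution $\bm{M}^\star$ of the primal problem $\min_{\bm{M}\succeq\bm{O}}P_\lambda(\bm{M})$ satisfies $$\left\|\bm{M}^\star-\bm{M}\right\|_F^2\le \frac{2\left(P_{\lambda}(\bm{M})-D_{\lambda}(\bm{\alpha},\bm{\Gamma})\right)}{\lambda}.$$
   Context: Let $\bm{x}_1,\dots,\bm{x}_n\in\mathbb{R}^d$ have labels $y_1,\dots,y_n$ in a discrete set, and let $\mathcal{T}=\{(i,j,l)\in\{1,\dots,n\}^3\mid y_i=y_j,\ i\neq j,\ y_i\neq y_l\}$. For $(i,j,l)\in\mathcal{T}$ put $\bm{H}_{ijl}=(\bm{x}_i-\bm{x}_l)(\bm{x}_i-\bm{x}_l)^\top-(\bm{x}_i-\bm{x}_j)(\bm{x}_i-\bm{x}_j)^\top$. $\langle \bm{A},\bm{B}\rangle=\mathrm{tr}(\bm{A}^\top\bm{B})$, $\|\bm{A}\|_F^2=\langle\bm{A},\bm{A}\rangle$, and $\bm{M}\succeq\bm{O}$ means that $\bm{M}\in\mathbb{R}^{d\times d}$ is (symmetric) positive semi-definite. The loss $\ell:\mathbb{R}\to\mathbb{R}$ is either the hinge loss $\ell(x)=\max\{0,1-x\}$ (parameter $\gamma=0$), or, for a parameter $\gamma>0$,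 the smoothed hinge loss: $\ell(x)=0$ for $x>1$, $\ell(x)=\frac{1}{2\gamma}(1-x)^2$ for $1-\gamma\le x\le1$, $\ell(x)=1-x-\frac{\gamma}{2}$ for $x<1-\gamma$. Primal objective: $P_\lambda(\bm{M})=\sum_{(i,j,l)\in\mathcal{T}}\ell(\langle\bm{M},\bm{H}_{ijl}\rangle)+\frac{\lambda}{2}\|\bm{M}\|_F^2$, minimized over $\bm{M}\succeq\bm{O}$. Dual objective: for $\bm{\alpha}=(\alpha_{ijl})\in\mathbb{R}^{|\mathcal{T}|}$ and $\bm{\Gamma}\in\mathbb{R}^{d\times d}$, $D_\lambda(\bm{\alpha},\bm{\Gamma})=-\frac{\gamma}{2}\|\bm{\alpha}\|_2^2+\bm{\alpha}^\top\bm{1}-\frac{\lambda}{2}\|\bm{M}_\lambda(\bm{\alpha},\bm{\Gamma})\|_F^2$, where $\bm{M}_\lambda(\bm{\alpha},\bm{\Gamma})=\frac{1}{\lambda}\left[\sum_{(i,j,l)\in\mathcal{T}}\alpha_{ijl}\bm{H}_{ijl}+\bm{\Gamma}\right]$; it is maximized over $\bm{0}\le\bm{\alpha}\le\bm{1}$ (componentwise), $\bm{\Gamma}\succeq\bm{O}$. *)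

theory Defs
  imports "HOL-Analysis.Analysis"
begin

definition frob_inner :: "real^'d^'d \<Rightarrow> real^'d^'d \<Rightarrow> real" where
  "frob_inner A B = trace (transpose A ** B)"

definition frob_norm :: "real^'d^'d \<Rightarrow> real" where
  "frob_norm A = sqrt (frob_inner A A)"

(* The Frobenius structure is the one the library puts on real^'d^'d. *)

lemma frob_inner_eq_inner: "frob_inner A B = A \<bullet> B"
proof -
  have "frob_inner A B = (\<Sum>i\<in>UNIV. \<Sum>k\<in>UNIV. A $ k $ i * B $ k $ i)"
    by (simp add: frob_inner_def trace_def matrix_matrix_mult_def transpose_def)
  also have "\<dots> = (\<Sum>k\<in>UNIV. \<Sum>i\<in>UNIV. A $ k $ i * B $ k $ i)"
    by (rule sum.swap)
  finally show ?thesis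
    by (simp add: inner_vec_def)
qed

lemma frob_norm_eq_norm: "frob_norm A = norm A"
  by (simp add: frob_norm_def frob_inner_eq_inner norm_eq_sqrt_inner)

definition psd :: "real^'d^'d \<Rightarrow> bool" where
  "psd M \<longleftrightarrow> transpose M = M \<and> (\<forall>v. 0 \<le> v \<bullet> (M *v v))"

definition outer_prod :: "real^'d \<Rightarrow> real^'d \<Rightarrow> real^'d^'d" where
  "outer_prod u v = (\<chi> a b. u $ a * v $ b)"

(* Samples and labels are functions on nat of which only the values on {1..n} matter. *)

definition triplets :: "nat \<Rightarrow> (nat \<Rightarrow> 'c) \<Rightarrow> (nat \<times> nat \<times> nat) set" where
  "triplets n y = {(i, j, l). i \<in> {1..n} \<and> j \<in> {1..n} \<and> l \<in> {1..n} \<and>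
                     y i = y j \<and> i \<noteq> j \<and> y i \<noteq> y l}"

definition Hmat :: "(nat \<Rightarrow> real^'d) \<Rightarrow> nat \<Rightarrow> nat \<Rightarrow> nat \<Rightarrow> real^'d^'d" where
  "Hmat x i j l = outer_prod (x i - x l) (x i - x l) - outer_prod (x i - x j) (x i - x j)"

definition hinge :: "real \<Rightarrow> real" where
  "hinge t = max 0 (1 - t)"

definition smoothed_hinge :: "real \<Rightarrow> real \<Rightarrow> real" where
  "smoothed_hinge \<gamma> t =
     (if t > 1 then 0
      else if 1 - \<gamma> \<le> t then (1 - t)\<^sup>2 / (2 * \<gamma>)
      else 1 - t - \<gamma> / 2)"

(* Meant for \<gamma> \<ge> 0; the value \<gamma> = 0 selects the plain hinge loss. *)

definition loss :: "real \<Rightarrow> real \<Rightarrow> real" where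
  "loss \<gamma> = (if \<gamma> = 0 then hinge else smoothed_hinge \<gamma>)"

definition primal_obj ::
  "nat \<Rightarrow> (nat \<Rightarrow> real^'d) \<Rightarrow> (nat \<Rightarrow> 'c) \<Rightarrow> real \<Rightarrow> real \<Rightarrow> real^'d^'d \<Rightarrow> real" where
  "primal_obj n x y \<gamma> lam M =
     (\<Sum>(i, j, l)\<in>triplets n y. loss \<gamma> (frob_inner M (Hmat x i j l))) + lam / 2 * (frob_norm M)\<^sup>2"

(* A dual vector in R^|T| is a function of three indices, only its values on the triplets being used. *)

definition dual_matrix ::
  "nat \<Rightarrow> (nat \<Rightarrow> real^'d) \<Rightarrow> (nat \<Rightarrow> 'c) \<Rightarrow> real \<Rightarrow>
   (nat \<Rightarrow> nat \<Rightarrow> nat \<Rightarrow> real) \<Rightarrow> real^'d^'d \<Rightarrow> real^'d^'d" where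
  "dual_matrix n x y lam \<alpha> \<Gamma> =
     (1 / lam) *\<^sub>R ((\<Sum>(i, j, l)\<in>triplets n y. \<alpha> i j l *\<^sub>R Hmat x i j l) + \<Gamma>)"

definition dual_obj ::
  "nat \<Rightarrow> (nat \<Rightarrow> real^'d) \<Rightarrow> (nat \<Rightarrow> 'c) \<Rightarrow> real \<Rightarrow> real \<Rightarrow>
   (nat \<Rightarrow> nat \<Rightarrow> nat \<Rightarrow> real) \<Rightarrow> real^'d^'d \<Rightarrow> real" where
  "dual_obj n x y \<gamma> lam \<alpha> \<Gamma> =
     - (\<gamma> / 2) * (\<Sum>(i, j, l)\<in>triplets n y. (\<alpha> i j l)\<^sup>2)
     + (\<Sum>(i, j, l)\<in>triplets n y. \<alpha> i j l)
     - lam / 2 * (frob_norm (dual_matrix n x y lam \<alpha> \<Gamma>))\<^sup>2"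

end

theory Submission
  imports Defs
begin

text \<open>
  The loss is the conjugate \<open>loss \<gamma> t = max {a * (1 - t) - \<gamma> / 2 * a\<^sup>2 | a. 0 \<le> a \<le> 1}\<close>.
  Being a maximum of affine functions it is convex, so the primal objective is
  strongly convex with modulus \<open>lam\<close>, and at the minimiser this gives
  \<open>lam / 2 * \<parallel>M\<^sup>\<star> - M\<parallel>\<^sup>2 \<le> P(M) - P(M\<^sup>\<star>)\<close>.
  Inserting the dual variables into the same formula, together with
  \<open>\<langle>M\<^sup>\<star>, \<Gamma>\<rangle> \<ge> 0\<close>, gives weak duality \<open>D(\<alpha>, \<Gamma>) \<le> P(M\<^sup>\<star>)\<close>.
\<close>

section \<open>Positive semi-definite matrices\<close>

lemma psd_add:
  assumes "psd A" "psd B"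
  shows "psd (A + B)"
  using assms
  by (auto simp: psd_def transpose_def vec_eq_iff matrix_vector_mult_add_rdistrib inner_add_right)

lemma psd_scaleR:
  assumes "psd A" "0 \<le> c"
  shows "psd (c *\<^sub>R A)"
  using assms
  by (auto simp: psd_def transpose_def vec_eq_iff scaleR_matrix_vector_assoc [symmetric])

lemma inner_matrix_vector_symmetric:
  fixes A :: "real^'d^'d"
  assumes "transpose A = A"
  shows "u \<bullet> (A *v v) = v \<bullet> (A *v u)"
  by (metis assms dot_lmul_matrix inner_commute transpose_matrix_vector)

lemma quadratic_nonneg_discriminant:
  fixes a b c :: real
  assumes nonneg: "\<And>t. 0 \<le> a + 2 * b * t + c * t\<^sup>2" and "0 \<le> c"
  shows "b\<^sup>2 \<le> a * c"
proof (cases "c = 0")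
  case True
  have "b = 0"
  proof (rule ccontr)
    assume "b \<noteq> 0"
    \<comment> \<open>With \<open>c = 0\<close> the expression is affine in \<open>t\<close>; this
      point is where it takes the value -1.\<close>
    then show False
      using nonneg [of "- (a + 1) / (2 * b)"] True by simp
  qed
  then show ?thesis
    using True by simp
next
  case False
  \<comment> \<open>The vertex of the parabola, where nonnegativity is sharpest.\<close>
  with \<open>0 \<le> c\<close> have "0 < c" by simp
  then have "a + 2 * b * (- b / c) + c * (- b / c)\<^sup>2 = (a * c - b\<^sup>2) / c"
    by (simp add: field_simps power2_eq_square)
  then show ?thesis
    using nonneg [of "- b / c"] \<open>0 < c\<close> by (simp add: zero_le_divide_iff)
qed

text \<open>The quadratic form of \<open>A\<close> is nonnegative along the whole line
  \<open>u + t *\<^sub>R v\<close>, so its discriminant as a polynomial in \<open>t\<close> cannot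
  be positive.\<close>

lemma psd_Cauchy_Schwarz:
  fixes A :: "real^'d^'d"
  assumes "psd A"
  shows "(u \<bullet> (A *v v))\<^sup>2 \<le> (u \<bullet> (A *v u)) * (v \<bullet> (A *v v))"
proof (rule quadratic_nonneg_discriminant)
  fix t
  have "(u + t *\<^sub>R v) \<bullet> (A *v (u + t *\<^sub>R v))
      = u \<bullet> (A *v u) + 2 * (u \<bullet> (A *v v)) * t + v \<bullet> (A *v v) * t\<^sup>2"
    using inner_matrix_vector_symmetric [of A v u] assms
    by (simp add: psd_def matrix_vector_right_distrib inner_add_left inner_add_right
        matrix_vector_mult_scaleR power2_eq_square algebra_simps)
  then show "0 \<le> u \<bullet> (A *v u) + 2 * (u \<bullet> (A *v v)) * t + v \<bullet> (A *v v) * t\<^sup>2"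
    using assms by (metis psd_def)
  show "0 \<le> v \<bullet> (A *v v)"
    using assms by (simp add: psd_def)
qed

lemma inner_axis_matrix_axis:
  fixes A :: "real^'d^'d"
  shows "axis i 1 \<bullet> (A *v axis j 1) = A $ i $ j"
  by (simp add: inner_axis' matrix_vector_mult_basis column_def)

text \<open>Cauchy-Schwarz on two basis vectors bounds the squared entry by the product of two
  diagonal entries. Hence a vanishing diagonal entry annihilates its row.\<close>

lemma psd_entry_eq_0:
  fixes A :: "real^'d^'d"
  assumes "psd A" "A $ i $ i = 0"
  shows "A $ i $ j = 0"
  using psd_Cauchy_Schwarz [OF assms(1), of "axis i 1" "axis j 1"] assms(2)
  by (simp add: inner_axis_matrix_axis)

lemma outer_prod_mult_vec: "outer_prod u u *v v = (u \<bullet> v) *\<^sub>R u"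
  by (simp add: vec_eq_iff outer_prod_def matrix_vector_mult_def inner_vec_def
      sum_distrib_left algebra_simps)

lemma inner_outer_prod:
  fixes A :: "real^'d^'d"
  shows "A \<bullet> outer_prod u u = u \<bullet> (A *v u)"
  by (simp add: outer_prod_def matrix_vector_mult_def inner_vec_def
      sum_distrib_left algebra_simps)

text \<open>One step of symmetric elimination with pivot \<open>A $ i $ i\<close>. Cauchy-Schwarz
  against \<open>axis i 1\<close> says exactly that the subtracted square never exceeds the form of
  \<open>A\<close>.\<close>

lemma psd_Schur_complement:
  fixes A :: "real^'d^'d"
  assumes "psd A" "0 < A $ i $ i"
  shows "psd (A - (1 / A $ i $ i) *\<^sub>R outer_prod (A *v axis i 1) (A *v axis i 1))"
    (is "psd (A - ?c *\<^sub>R outer_prod ?w ?w)")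
  unfolding psd_def
proof (intro conjI allI)
  show "transpose (A - ?c *\<^sub>R outer_prod ?w ?w) = A - ?c *\<^sub>R outer_prod ?w ?w"
    using assms(1) by (auto simp: psd_def transpose_def outer_prod_def vec_eq_iff)
next
  fix v
  have "(v \<bullet> ?w)\<^sup>2 \<le> (v \<bullet> (A *v v)) * A $ i $ i"
    using psd_Cauchy_Schwarz [OF assms(1), of v "axis i 1"] by (simp add: inner_axis_matrix_axis)
  then have "?c * (v \<bullet> ?w)\<^sup>2 \<le> v \<bullet> (A *v v)"
    using assms(2) by (simp add: field_simps)
  then show "0 \<le> v \<bullet> ((A - ?c *\<^sub>R outer_prod ?w ?w) *v v)"
    by (simp add: matrix_vector_mult_diff_rdistrib scaleR_matrix_vector_assoc [symmetric]
        outer_prod_mult_vec inner_diff_right power2_eq_square inner_commute)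
qed

text \<open>Each elimination step on \<open>B\<close> splits off a nonnegative multiple of an outer square and
  clears one more diagonal entry, so no spectral theorem is needed.\<close>

lemma psd_inner_nonneg:
  fixes A B :: "real^'d^'d"
  assumes "psd A" "psd B"
  shows "0 \<le> A \<bullet> B"
  using assms(2)
proof (induction "card {i. B $ i $ i \<noteq> 0}" arbitrary: B rule: less_induct)
  case less
  show ?case
  proof (cases "\<forall>i. B $ i $ i = 0")
    case True
    then have "B = 0"
      using psd_entry_eq_0 [OF less.prems] by (simp add: vec_eq_iff)
    then show ?thesis by simp
  next
    case False
    then obtain i where i: "B $ i $ i \<noteq> 0" by blast
    have "0 \<le> axis i 1 \<bullet> (B *v axis i 1)"
      using less.prems unfolding psd_def by blast
    with i have pos: "0 < B $ i $ i"
      by (simp add: inner_axis_matrix_axis)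
    define w where "w = B *v axis i 1"
    define C where "C = B - (1 / B $ i $ i) *\<^sub>R outer_prod w w"
    have w: "w $ j = B $ j $ i" for j
      by (simp add: w_def matrix_vector_mult_basis column_def)
    have "psd C"
      unfolding C_def w_def by (rule psd_Schur_complement [OF less.prems pos])
    \<comment> \<open>The set of nonzero diagonal entries must shrink: zeros of \<open>B\<close>
      persist because their rows vanish, and the pivot entry becomes a new zero.\<close>
    have "C $ j $ j = 0" if "B $ j $ j = 0" for j
      using that psd_entry_eq_0 [OF less.prems that] by (simp add: C_def outer_prod_def w)
    moreover have "C $ i $ i = 0"
      using pos by (simp add: C_def outer_prod_def w)
    ultimately have "{j. C $ j $ j \<noteq> 0} \<subset> {j. B $ j $ j \<noteq> 0}"
      using i by blast
    then have "0 \<le> A \<bullet> C"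
      by (intro less.hyps \<open>psd C\<close> psubset_card_mono) auto
    moreover have "A \<bullet> B = A \<bullet> C + (1 / B $ i $ i) * (w \<bullet> (A *v w))"
      by (simp add: C_def inner_diff_right inner_outer_prod)
    moreover have "0 \<le> w \<bullet> (A *v w)"
      using assms(1) by (simp add: psd_def)
    ultimately show ?thesis
      using pos by simp
  qed
qed

section \<open>The loss as a conjugate\<close>

lemma loss_ge:
  assumes "0 \<le> \<gamma>" "0 \<le> a" "a \<le> 1"
  shows "a * (1 - t) - \<gamma> / 2 * a\<^sup>2 \<le> loss \<gamma> t"
proof (cases "\<gamma> = 0")
  case True
  have "a * (1 - t) \<le> max 0 (1 - t)"
    using assms mult_left_le_one_le [of "1 - t" a] mult_nonneg_nonpos [of a "1 - t"]
    by (cases "t \<le> 1") auto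
  then show ?thesis
    using True by (simp add: loss_def hinge_def)
next
  case False
  with assms have \<gamma>: "0 < \<gamma>" by simp
  consider "t > 1" | "t \<le> 1" "1 - \<gamma> \<le> t" | "t \<le> 1" "t < 1 - \<gamma>" by linarith
  then show ?thesis
  proof cases
    case 1
    then have "a * (1 - t) \<le> 0" using assms by (simp add: mult_nonneg_nonpos)
    also have "0 \<le> \<gamma> / 2 * a\<^sup>2" using \<gamma> by simp
    finally show ?thesis using 1 \<gamma> by (simp add: loss_def smoothed_hinge_def)
  next
    case 2
    \<comment> \<open>On the quadratic piece the gap is a completed square, zero at
      \<open>a = (1 - t) / \<gamma>\<close>.\<close>
    have "0 \<le> (1 - t - \<gamma> * a)\<^sup>2 / (2 * \<gamma>)" using \<gamma> by simp
    also have "\<dots> = (1 - t)\<^sup>2 / (2 * \<gamma>) - (a * (1 - t) - \<gamma> / 2 * a\<^sup>2)"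
      using \<gamma> by (simp add: field_simps power2_eq_square)
    finally show ?thesis using 2 \<gamma> by (simp add: loss_def smoothed_hinge_def)
  next
    case 3
    \<comment> \<open>On the linear piece the gap vanishes at \<open>a = 1\<close>; expanding it in
      powers of \<open>1 - a\<close> makes both terms visibly nonnegative.\<close>
    have "0 \<le> (1 - a) * (1 - t - \<gamma>) + \<gamma> / 2 * (1 - a)\<^sup>2"
      using 3 \<gamma> assms by (intro add_nonneg_nonneg mult_nonneg_nonneg) auto
    also have "\<dots> = 1 - t - \<gamma> / 2 - (a * (1 - t) - \<gamma> / 2 * a\<^sup>2)"
      by (simp add: field_simps power2_eq_square)
    finally show ?thesis using 3 \<gamma> by (simp add: loss_def smoothed_hinge_def)
  qed
qed

text \<open>For positive \<open>\<gamma>\<close> the maximiser is \<open>(1 - t) / \<gamma>\<close>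
  clipped to the unit interval, and the three cases are the clipping regimes. For
  \<open>\<gamma> = 0\<close> the expression is linear in \<open>a\<close>, so an endpoint
  works.\<close>

lemma loss_attained:
  assumes "0 \<le> \<gamma>"
  obtains a where "0 \<le> a" "a \<le> 1" "loss \<gamma> t = a * (1 - t) - \<gamma> / 2 * a\<^sup>2"
proof -
  consider "t > 1" | "t \<le> 1" "\<gamma> > 0" "1 - \<gamma> \<le> t" | "t \<le> 1" "\<gamma> = 0 \<or> t < 1 - \<gamma>"
    using assms by linarith
  then show ?thesis
  proof cases
    case 1
    then show ?thesis
      by (intro that [of 0]) (auto simp: loss_def hinge_def smoothed_hinge_def)
  next
    case 2
    then show ?thesis
      by (intro that [of "(1 - t) / \<gamma>"])
        (auto simp: loss_def smoothed_hinge_def field_simps power2_eq_square)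
  next
    case 3
    then show ?thesis
      by (intro that [of 1]) (auto simp: loss_def hinge_def smoothed_hinge_def)
  qed
qed

lemma convex_on_loss:
  assumes "0 \<le> \<gamma>"
  shows "convex_on UNIV (loss \<gamma>)"
proof (rule convex_onI)
  fix t r s :: real
  assume t: "0 < t" "t < 1"
  \<comment> \<open>The affine minorant touching the loss at the mixed point still lies below it at
    \<open>r\<close> and \<open>s\<close>.\<close>
  obtain a where a: "0 \<le> a" "a \<le> 1"
    and eq: "loss \<gamma> ((1 - t) *\<^sub>R r + t *\<^sub>R s) = a * (1 - ((1 - t) *\<^sub>R r + t *\<^sub>R s)) - \<gamma> / 2 * a\<^sup>2"
    using loss_attained [OF assms] by blast
  have "loss \<gamma> ((1 - t) *\<^sub>R r + t *\<^sub>R s)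
      = (1 - t) * (a * (1 - r) - \<gamma> / 2 * a\<^sup>2) + t * (a * (1 - s) - \<gamma> / 2 * a\<^sup>2)"
    unfolding eq by (simp add: field_simps)
  also have "\<dots> \<le> (1 - t) * loss \<gamma> r + t * loss \<gamma> s"
    using t a assms by (intro add_mono mult_left_mono loss_ge) auto
  finally show "loss \<gamma> ((1 - t) *\<^sub>R r + t *\<^sub>R s) \<le> (1 - t) * loss \<gamma> r + t * loss \<gamma> s" .
qed simp

section \<open>Strong convexity and weak duality\<close>

lemma norm_convex_combination:
  fixes a b :: "'a::real_inner"
  shows "(norm ((1 - t) *\<^sub>R a + t *\<^sub>R b))\<^sup>2
    = (1 - t) * (norm a)\<^sup>2 + t * (norm b)\<^sup>2 - t * (1 - t) * (norm (a - b))\<^sup>2"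
  by (simp add: power2_norm_eq_inner inner_add_left inner_add_right inner_diff_left
      inner_diff_right inner_commute [of b a] algebra_simps)

text \<open>The loss part is convex because its arguments are linear in the matrix; the quadratic
  defect comes entirely from the regulariser, by the exact identity for the squared norm.\<close>

lemma primal_obj_strongly_convex:
  fixes A B :: "real^'d^'d"
  assumes "0 \<le> \<gamma>" "0 \<le> t" "t \<le> 1"
  shows "primal_obj n x y \<gamma> lam ((1 - t) *\<^sub>R A + t *\<^sub>R B)
    \<le> (1 - t) * primal_obj n x y \<gamma> lam A + t * primal_obj n x y \<gamma> lam B
      - lam / 2 * (t * (1 - t) * (norm (A - B))\<^sup>2)"
proof -
  define L where "L C = (\<Sum>(i, j, l)\<in>triplets n y. loss \<gamma> (C \<bullet> Hmat x i j l))" for C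
  have P: "primal_obj n x y \<gamma> lam C = L C + lam / 2 * (norm C)\<^sup>2" for C
    by (simp add: primal_obj_def L_def frob_inner_eq_inner frob_norm_eq_norm)
  have "L ((1 - t) *\<^sub>R A + t *\<^sub>R B)
      \<le> (\<Sum>(i, j, l)\<in>triplets n y.
          (1 - t) * loss \<gamma> (A \<bullet> Hmat x i j l) + t * loss \<gamma> (B \<bullet> Hmat x i j l))"
    unfolding L_def
    using convex_onD [OF convex_on_loss [OF assms(1)] assms(2,3)]
    by (intro sum_mono) (auto simp: inner_add_left)
  also have "\<dots> = (1 - t) * L A + t * L B"
    by (simp add: L_def sum.distrib sum_distrib_left split_def)
  finally show ?thesis
    unfolding P norm_convex_combination by (simp add: field_simps)
qed

lemma primal_obj_growth:
  fixes M Mstar :: "real^'d^'d"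
  assumes "0 \<le> \<gamma>" "psd M" "is_arg_min (primal_obj n x y \<gamma> lam) psd Mstar"
  shows "lam / 2 * (norm (Mstar - M))\<^sup>2 \<le> primal_obj n x y \<gamma> lam M - primal_obj n x y \<gamma> lam Mstar"
\<comment> \<open>Comparing \<open>Mstar\<close> with the point of weight \<open>1 - z\<close> on
  \<open>M\<close> and cancelling \<open>1 - z\<close> gives the bound up to a factor
  \<open>z\<close>, which then tends to 1. This avoids subgradients at the kink of the
  hinge.\<close>
proof (rule field_le_mult_one_interval)
  fix z :: real
  assume z: "0 < z" "z < 1"
  let ?P = "primal_obj n x y \<gamma> lam"
  have "psd Mstar" and min: "\<And>A. psd A \<Longrightarrow> ?P Mstar \<le> ?P A"
    using assms(3) by (auto simp: is_arg_min_def not_less)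
  then have "psd ((1 - (1 - z)) *\<^sub>R Mstar + (1 - z) *\<^sub>R M)"
    using assms(2) z by (intro psd_add psd_scaleR) auto
  then have "?P Mstar \<le> ?P ((1 - (1 - z)) *\<^sub>R Mstar + (1 - z) *\<^sub>R M)"
    by (rule min)
  also have "\<dots> \<le> (1 - (1 - z)) * ?P Mstar + (1 - z) * ?P M
      - lam / 2 * ((1 - z) * (1 - (1 - z)) * (norm (Mstar - M))\<^sup>2)"
    using z by (intro primal_obj_strongly_convex assms(1)) auto
  finally have "(1 - z) * (z * (lam / 2 * (norm (Mstar - M))\<^sup>2)) \<le> (1 - z) * (?P M - ?P Mstar)"
    by (simp add: field_simps)
  then show "z * (lam / 2 * (norm (Mstar - M))\<^sup>2) \<le> ?P M - ?P Mstar"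
    using z by simp
qed

lemma weak_duality:
  fixes M \<Gamma> :: "real^'d^'d"
  assumes "0 \<le> \<gamma>" "0 < lam" "psd M" "psd \<Gamma>"
    and \<alpha>: "\<forall>(i, j, l)\<in>triplets n y. 0 \<le> \<alpha> i j l \<and> \<alpha> i j l \<le> 1"
  shows "dual_obj n x y \<gamma> lam \<alpha> \<Gamma> \<le> primal_obj n x y \<gamma> lam M"
proof -
  let ?T = "triplets n y"
  define S where "S = (\<Sum>(i, j, l)\<in>?T. \<alpha> i j l *\<^sub>R Hmat x i j l)"
  define N where "N = dual_matrix n x y lam \<alpha> \<Gamma>"
  have S: "S = lam *\<^sub>R N - \<Gamma>"
    using assms(2) by (simp add: S_def N_def dual_matrix_def)
  have "- (\<gamma> / 2) * (\<Sum>(i, j, l)\<in>?T. (\<alpha> i j l)\<^sup>2) + (\<Sum>(i, j, l)\<in>?T. \<alpha> i j l) - M \<bullet> S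
      = (\<Sum>(i, j, l)\<in>?T. \<alpha> i j l * (1 - M \<bullet> Hmat x i j l) - \<gamma> / 2 * (\<alpha> i j l)\<^sup>2)"
    by (simp add: S_def inner_sum_right split_def sum_subtractf sum_negf sum_distrib_left right_diff_distrib)
  also have "\<dots> \<le> (\<Sum>(i, j, l)\<in>?T. loss \<gamma> (M \<bullet> Hmat x i j l))"
    using \<alpha> assms(1) by (intro sum_mono) (unfold split_def, intro loss_ge, auto)
  finally have loss_bound: "- (\<gamma> / 2) * (\<Sum>(i, j, l)\<in>?T. (\<alpha> i j l)\<^sup>2) + (\<Sum>(i, j, l)\<in>?T. \<alpha> i j l)
      \<le> (\<Sum>(i, j, l)\<in>?T. loss \<gamma> (M \<bullet> Hmat x i j l)) + M \<bullet> S"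
    by simp
  \<comment> \<open>Since \<open>lam *\<^sub>R N = S + \<Gamma>\<close>, the cross term of the
    square is \<open>- (M \<bullet> S) - M \<bullet> \<Gamma>\<close>. Adding
    \<open>M \<bullet> \<Gamma>\<close> leaves just the term needed to cancel
    \<open>M \<bullet> S\<close> in \<open>loss_bound\<close>.\<close>
  have "0 \<le> lam / 2 * (norm (M - N))\<^sup>2 + M \<bullet> \<Gamma>"
    using assms psd_inner_nonneg by (intro add_nonneg_nonneg) auto
  also have "\<dots> = lam / 2 * (norm M)\<^sup>2 + lam / 2 * (norm N)\<^sup>2 - M \<bullet> S"
    by (simp add: S power2_norm_eq_inner inner_diff_left inner_diff_right
        inner_commute [of N M] field_simps)
  finally show ?thesis
    using loss_bound
    by (simp add: dual_obj_def primal_obj_def frob_inner_eq_inner frob_norm_eq_norm flip: N_def)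
qed

theorem theorem3p5:
  fixes n :: nat
    and x :: "nat \<Rightarrow> real^'d"
    and y :: "nat \<Rightarrow> 'c"
    and \<gamma> lam :: real
    and M Mstar \<Gamma> :: "real^'d^'d"
    and \<alpha> :: "nat \<Rightarrow> nat \<Rightarrow> nat \<Rightarrow> real"
  assumes "\<gamma> \<ge> 0"
    and "lam > 0"
    and "psd M"
    and "\<forall>(i, j, l)\<in>triplets n y. 0 \<le> \<alpha> i j l \<and> \<alpha> i j l \<le> 1"
    and "psd \<Gamma>"
    and "is_arg_min (primal_obj n x y \<gamma> lam) psd Mstar"
  shows "(frob_norm (Mstar - M))\<^sup>2 \<le> 2 * (primal_obj n x y \<gamma> lam M - dual_obj n x y \<gamma> lam \<alpha> \<Gamma>) / lam"
proof -
  have "psd Mstar"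
    using assms(6) by (simp add: is_arg_min_def)
  then have "dual_obj n x y \<gamma> lam \<alpha> \<Gamma> \<le> primal_obj n x y \<gamma> lam Mstar"
    by (intro weak_duality assms)
  moreover have "lam / 2 * (norm (Mstar - M))\<^sup>2
      \<le> primal_obj n x y \<gamma> lam M - primal_obj n x y \<gamma> lam Mstar"
    by (rule primal_obj_growth [OF assms(1,3,6)])
  ultimately show ?thesis
    using assms(2) by (simp add: frob_norm_eq_norm field_simps)
qed

end
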